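(* Let $n\ge 3$ and let $\hat\gamma(t)=\gamma(t)+\vec\lambda(t)$, $t\in(-\varepsilon,\varepsilon)$, be a smooth curve in $\mathbb{L}(n)$, where $\gamma(t)=z(t)\big(0,1,r_3(t),\dots,r_n(t)\big)$ with smooth $z\colon(-\varepsilon,\varepsilon)\to\mathbb{C}\smallsetminus\{0\}$, $r_j\colon(-\varepsilon,\varepsilon)\to\mathbb{R}$, and $\vec\lambda(t)=(\lambda(t),\dots,\lambda(t))$ with smooth $\lambda\colon(-\varepsilon,\varepsilon)\to\mathbb{C}$. Then $\hat\gamma$ is a geodesic of $\mathbb{L}(n)$ if and only if, for all $t\in(-\varepsilon,\varepsilon)$ (argument $t$ omitted): (I') $\displaystyle \Big[\Big(1+\sum_{j=3}^n r_j^2\Big)z''+2\Big(\sum_{j=3}^n r_jr_j'\Big)z'+\Big(1+\sum_{j=3}^n r_j\Big)\lambda''\Big]\cdot iz=0$; (II') $z''\cdot z+\lambda''\cdot z=0$; (III') $z\cdot\big[r_j''z+2r_j'z'+(r_j-1)z''\big]=0$ for each $3\le j\le n$; (IV') $\displaystyle \Big(1+\sum_{j=3}^n r_j\Big)z''+2\Big(\sum_{j=3}^n r_j'\Big)z'+\Big(\sum_{j=3}^n r_j''\Big)z+n\lambda''=0$; (V') there is a real constant $k_0$ such that $$\sum_{j=3}^n (r_j')^2\|z\|^2+\sum_{j=3}^n 2r_j'r_j\,(z\cdot z')+\Big(1+\sum_{j=3}^n r_j^2\Big)\|z'\|^2+2\Big(\sum_{j=3}^n r_j'\Big)z\cdot\lambda'+2\Big(1+\sum_{j=3}^n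 r_j\Big)z'\cdot\lambda'+n\|\lambda'\|^2=k_0 .$$
   Context: Let $n\ge 3$ and $\mathcal{D}_n=\{(b,\dots,b)\in\mathbb{C}^n : b\in\mathbb{C}\}$. $\mathbb{L}(n)\subset\mathbb{C}^n$ is the set of $n$-segments: points $(z_1,\dots,z_n)\in\mathbb{C}^n\smallsetminus\mathcal{D}_n$ such that $z_1,\dots,z_n$ lie on a common real straight line in $\mathbb{C}$. It is a smooth real $(n+2)$-dimensional submanifold of $\mathbb{C}^n\cong\mathbb{R}^{2n}$. For complex numbers, $z\cdot w=\mathrm{Re}(z\overline w)$ is the Euclidean inner product in the plane and $\|z\|=|z|$. $\mathbb{C}^n\cong\mathbb{R}^{2n}$ carries the Euclidean inner product $\langle\!\langle Z,W\rangle\!\rangle=\sum_j z_j\cdot w_j$, and $\mathbb{L}(n)$ the induced Riemannian metric. A curve $\hat\gamma$ in $\mathbb{L}(n)$ is a geodesic if it has constant speed and $\hat\gamma''(t)$ is orthogonal to the (linear) tangent space of $\mathbb{L}(n)$ at $\hat\gamma(t)$ for every $t$. *)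

theory Defs
  imports "HOL-Analysis.Analysis"
begin

text \<open>
  The space of complex n-tuples is \<^typ>\<open>complex ^ 'n\<close>. Its library inner product is the sum over
  the coordinates of the planar inner products \<open>z \<bullet> w = Re (z * cnj w)\<close>.
\<close>

definition diagonal_tuples :: "(complex ^ 'n) set" where
  "diagonal_tuples = {Z. \<exists>b. Z = (\<chi> k. b)}"

definition segments :: "(complex ^ 'n) set" where
  "segments = {Z. Z \<notin> diagonal_tuples \<and> collinear (range (\<lambda>k. Z $ k))}"

abbreviation vd :: "(real \<Rightarrow> 'a::real_normed_vector) \<Rightarrow> real \<Rightarrow> 'a" where
  "vd f \<equiv> (\<lambda>t. vector_derivative f (at t))"

text \<open>
  Infinite differentiability on an open set \<open>I\<close> of parameters: \<open>D k\<close> is the derivative of order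
  \<open>k\<close>. Values of \<open>f\<close> outside \<open>I\<close> play no role.
\<close>

definition smooth_curve_on :: "real set \<Rightarrow> (real \<Rightarrow> 'a::real_normed_vector) \<Rightarrow> bool" where
  "smooth_curve_on I f \<longleftrightarrow>
     (\<exists>D :: nat \<Rightarrow> real \<Rightarrow> 'a. (\<forall>t\<in>I. D 0 t = f t) \<and>
        (\<forall>k. \<forall>t\<in>I. (D k has_vector_derivative D (Suc k) t) (at t)))"

text \<open>
  The linear tangent space at \<open>p\<close> of a smooth submanifold \<open>M\<close> of a normed space: the velocities
  at \<open>p\<close> of the smooth curves that lie in \<open>M\<close>.
\<close>

definition tangent_space :: "'a::real_normed_vector set \<Rightarrow> 'a \<Rightarrow> 'a set" where
  "tangent_space M p =
     {v. \<exists>\<delta>>0. \<exists>c. smooth_curve_on {-\<delta><..<\<delta>} c \<and> (\<forall>t\<in>{-\<delta><..<\<delta>}. c t \<in> M) \<and>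
           c 0 = p \<and> (c has_vector_derivative v) (at 0)}"

text \<open>Geodesics of \<open>M\<close> with the metric induced from the ambient inner product; \<open>I\<close> is open.\<close>

definition geodesic_on :: "real set \<Rightarrow> 'a::real_inner set \<Rightarrow> (real \<Rightarrow> 'a) \<Rightarrow> bool" where
  "geodesic_on I M c \<longleftrightarrow>
     smooth_curve_on I c \<and> (\<forall>t\<in>I. c t \<in> M) \<and>
     (\<exists>s. \<forall>t\<in>I. norm (vd c t) = s) \<and>
     (\<forall>t\<in>I. \<forall>v\<in>tangent_space M (c t). orthogonal (vd (vd c) t) v)"

text \<open>
  The tuple \<open>(0, 1, \<rho> 3, \<dots>, \<rho> n)\<close>, where \<open>pos\<close> is the numbering of the coordinates by
  \<open>1, \<dots>, n\<close>.
\<close>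

definition shape_tuple :: "('n \<Rightarrow> nat) \<Rightarrow> (nat \<Rightarrow> real) \<Rightarrow> complex ^ 'n" where
  "shape_tuple pos \<rho> =
     (\<chi> k. if pos k = 1 then 0 else if pos k = 2 then 1 else complex_of_real (\<rho> (pos k)))"

end

theory Submission
  imports Defs
begin

text \<open>
  Velocities at \<open>l + s k * z\<close> of curves of collinear tuples are the tuples \<open>m + s k * w + x k * z\<close> with
  \<open>m\<close>, \<open>w\<close> complex and \<open>x k\<close> real: differentiate \<open>Im ((c k - c j) * cnj (c i - c j)) = 0\<close> for one
  inclusion, and vary \<open>l\<close>, \<open>z\<close>, \<open>s\<close> linearly for the other. Hence the acceleration \<open>a\<close> is normal iff
  \<open>\<Sum>k. a k = 0\<close>, \<open>\<Sum>k. s k * a k = 0\<close> and every \<open>a k\<close> is orthogonal to \<open>z\<close>. The first condition is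
  (IV'), the last one for the indices \<open>2, \<dots>, n\<close> is (II') and (III') (for the index 1 it follows
  from the sum), and then only the component of \<open>\<Sum>k. s k * a k\<close> along \<open>\<i> * z\<close>, which is (I'), remains.
  Constant speed is (V').
\<close>

section \<open>Smooth curves\<close>

text \<open>A tuple is the finite sum of its coordinates placed by the maps \<open>axis k\<close>.
  These are linear isometries, so differentiation passes through them.\<close>

lemma has_vector_derivative_vec_lambda:
  fixes f :: "'n::finite \<Rightarrow> real \<Rightarrow> 'a::real_normed_vector"
  assumes "\<And>k. (f k has_vector_derivative f' k) F"
  shows "((\<lambda>t. \<chi> k. f k t) has_vector_derivative (\<chi> k. f' k)) F"
proof -
  have "norm (axis k x :: 'a ^ 'n) = norm x" for k x
    by (simp add: norm_vec_def L2_set_def axis_def if_distrib[of norm] if_distrib[of "\<lambda>y. y\<^sup>2"]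
        cong: if_cong)
  then have axis: "bounded_linear (axis k :: 'a \<Rightarrow> 'a ^ 'n)" for k
    by (intro bounded_linear_intro[where K = 1]) (simp_all add: axis_def vec_eq_iff)
  have sum_axis: "(\<Sum>k\<in>UNIV. axis k (g k)) = (\<chi> k. g k)" for g :: "'n \<Rightarrow> 'a"
    by (auto simp: vec_eq_iff axis_def)
  have "((\<lambda>t. \<Sum>k\<in>UNIV. axis k (f k t)) has_vector_derivative (\<Sum>k\<in>UNIV. axis k (f' k))) F"
    by (intro has_vector_derivative_sum bounded_linear.has_vector_derivative[OF axis] assms)
  then show ?thesis
    by (simp only: sum_axis)
qed

text \<open>Having a given derivative at a point is a local property. This lets a velocity formula
  that is known only on \<open>I\<close> be differentiated once more.\<close>

lemma vd_cong_on:
  assumes "open I" and "\<And>t. t \<in> I \<Longrightarrow> f t = g t" and "t \<in> I"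
  shows "vd f t = vd g t"
proof -
  have "(f has_vector_derivative d) (at t) \<longleftrightarrow> (g has_vector_derivative d) (at t)" for d
    using assms by (metis has_vector_derivative_transform_within_open)
  then show ?thesis
    by (simp add: vector_derivative_def)
qed

text \<open>The family \<open>D\<close> in the definition of smoothness is constrained only on
  \<open>I\<close>. Since \<open>I\<close> is open, \<open>D 1\<close> equals \<open>vd f\<close> on
  all of \<open>I\<close>, not just at \<open>t\<close>, and so \<open>D 2\<close> is the derivative
  of \<open>vd f\<close>.\<close>

lemma smooth_curve_on_derivatives:
  assumes "open I" and "smooth_curve_on I f" and "t \<in> I"
  shows "(f has_vector_derivative vd f t) (at t)"
    and "(vd f has_vector_derivative vd (vd f) t) (at t)"
proof -
  obtain D where D0: "\<And>t. t \<in> I \<Longrightarrow> D 0 t = f t"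
    and D: "\<And>k t. t \<in> I \<Longrightarrow> (D k has_vector_derivative D (Suc k) t) (at t)"
    using assms(2) unfolding smooth_curve_on_def by blast
  have f: "(f has_vector_derivative D 1 t) (at t)" if "t \<in> I" for t
    using has_vector_derivative_transform_within_open[OF D[of t 0] assms(1)] that D0 by simp
  then have D1: "D 1 t = vd f t" if "t \<in> I" for t
    using vector_derivative_at[OF f[OF that]] by simp
  have f': "(vd f has_vector_derivative D 2 t) (at t)" if "t \<in> I" for t
    using has_vector_derivative_transform_within_open[OF D[of t 1] assms(1)] that D1
    by (simp add: numeral_2_eq_2)
  show "(f has_vector_derivative vd f t) (at t)"
    using f[OF assms(3)] D1[OF assms(3)] by simp
  show "(vd f has_vector_derivative vd (vd f) t) (at t)"
    using f'[OF assms(3)] vector_derivative_at[OF f'[OF assms(3)]] by simp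
qed

lemma smooth_curve_on_cong:
  assumes "smooth_curve_on I f" and "\<And>t. t \<in> I \<Longrightarrow> f t = g t"
  shows "smooth_curve_on I g"
  using assms unfolding smooth_curve_on_def by auto

lemma smooth_curve_on_affine: "smooth_curve_on I (\<lambda>t. a + t *\<^sub>R b)"
  unfolding smooth_curve_on_def
proof (intro exI[of _ "\<lambda>k t. if k = 0 then a + t *\<^sub>R b else if k = Suc 0 then b else 0"]
    conjI ballI allI)
  let ?D = "\<lambda>k t. if k = 0 then a + t *\<^sub>R b else if k = Suc 0 then b else 0"
  show "?D 0 t = a + t *\<^sub>R b" for t
    by simp
  show "(?D k has_vector_derivative ?D (Suc k) t) (at t)" for k t
    by (auto intro!: derivative_eq_intros)
qed

lemma smooth_curve_on_const: "smooth_curve_on I (\<lambda>t. a)"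
  using smooth_curve_on_affine[of I a 0] by simp

lemma smooth_curve_on_add:
  assumes "smooth_curve_on I f" and "smooth_curve_on I g"
  shows "smooth_curve_on I (\<lambda>t. f t + g t)"
proof -
  obtain F G where "\<forall>t\<in>I. F 0 t = f t"
    "\<forall>k. \<forall>t\<in>I. (F k has_vector_derivative F (Suc k) t) (at t)"
    "\<forall>t\<in>I. G 0 t = g t"
    "\<forall>k. \<forall>t\<in>I. (G k has_vector_derivative G (Suc k) t) (at t)"
    using assms unfolding smooth_curve_on_def by metis
  then show ?thesis
    unfolding smooth_curve_on_def
    by (intro exI[of _ "\<lambda>k t. F k t + G k t"]) (auto intro: has_vector_derivative_add)
qed

lemma smooth_curve_on_vec_lambda:
  fixes f :: "'n::finite \<Rightarrow> real \<Rightarrow> 'a::real_normed_vector"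
  assumes "\<And>k. smooth_curve_on I (f k)"
  shows "smooth_curve_on I (\<lambda>t. \<chi> k. f k t)"
proof -
  obtain F where "\<forall>k. (\<forall>t\<in>I. F k 0 t = f k t) \<and>
      (\<forall>m. \<forall>t\<in>I. (F k m has_vector_derivative F k (Suc m) t) (at t))"
    using assms unfolding smooth_curve_on_def by metis
  then show ?thesis
    unfolding smooth_curve_on_def
    by (intro exI[of _ "\<lambda>m t. \<chi> k. F k m t"])
      (auto intro: has_vector_derivative_vec_lambda simp: vec_eq_iff)
qed

text \<open>
  A list of pairs \<open>(i, j)\<close> stands for the sum of the products \<open>F i * G j\<close>; one application of the
  product rule replaces each pair by two, which avoids the binomial coefficients of Leibniz' formula.
\<close>

lemma smooth_curve_on_scaleR:
  assumes "smooth_curve_on I f" and "smooth_curve_on I g"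
  shows "smooth_curve_on I (\<lambda>t. f t *\<^sub>R g t)"
proof -
  obtain F G where F0: "\<forall>t\<in>I. F 0 t = f t"
    and F: "\<And>k t. t \<in> I \<Longrightarrow> (F k has_vector_derivative F (Suc k) t) (at t)"
    and G0: "\<forall>t\<in>I. G 0 t = g t"
    and G: "\<And>k t. t \<in> I \<Longrightarrow> (G k has_vector_derivative G (Suc k) t) (at t)"
    using assms unfolding smooth_curve_on_def by metis
  define S where "S xs t = (\<Sum>(i, j)\<leftarrow>xs. F i t *\<^sub>R G j t)" for xs :: "(nat \<times> nat) list" and t
  define step where "step xs = concat (map (\<lambda>(i, j). [(i, Suc j), (Suc i, j)]) xs)"
    for xs :: "(nat \<times> nat) list"
  have S: "(S xs has_vector_derivative S (step xs) t) (at t)" if t: "t \<in> I" for xs t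
  proof (induction xs)
    case Nil
    then show ?case
      by (simp add: S_def[abs_def] step_def)
  next
    case (Cons x xs)
    obtain i j where x: "x = (i, j)"
      by (cases x)
    have "((\<lambda>t. F i t *\<^sub>R G j t + S xs t) has_vector_derivative
        (F i t *\<^sub>R G (Suc j) t + F (Suc i) t *\<^sub>R G j t) + S (step xs) t) (at t)"
      using F[OF t, of i] unfolding has_real_derivative_iff_has_vector_derivative[symmetric]
      by (intro has_vector_derivative_add has_vector_derivative_scaleR G t Cons)
    then show ?case
      by (simp add: S_def[abs_def] step_def x add.assoc)
  qed
  show ?thesis
    unfolding smooth_curve_on_def
  proof (intro exI[of _ "\<lambda>k. S ((step ^^ k) [(0, 0)])"] conjI ballI allI)
    show "S ((step ^^ 0) [(0, 0)]) t = f t *\<^sub>R g t" if "t \<in> I" for t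
      using that F0 G0 by (simp add: S_def)
    show "(S ((step ^^ k) [(0, 0)]) has_vector_derivative S ((step ^^ Suc k) [(0, 0)]) t) (at t)"
      if "t \<in> I" for k t
      using S[OF that] by simp
  qed
qed

section \<open>The tangent space of the segments\<close>

text \<open>Up to sign, \<open>Im (x * cnj y)\<close> is the determinant of the plane vectors
  \<open>x\<close> and \<open>y\<close>, and here both are real multiples of one direction. In this
  form collinearity is an equation that can be differentiated along a curve.\<close>

lemma collinear_imp_Im_eq_0:
  assumes "collinear S" and "a \<in> S" and "b \<in> S" and "c \<in> S"
  shows "Im ((a - b) * cnj (c - b)) = 0"
proof -
  obtain u v where "\<forall>x\<in>S. \<exists>d. x = u + d *\<^sub>R v"
    using assms(1) unfolding collinear_alt by blast
  then obtain \<alpha> \<beta> \<kappa> where "a = u + \<alpha> *\<^sub>R v" "b = u + \<beta> *\<^sub>R v" "c = u + \<kappa> *\<^sub>R v"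
    using assms by metis
  then show ?thesis
    by (simp add: algebra_simps)
qed

text \<open>The assumption joins \<open>s k1 \<noteq> s k2\<close> and \<open>z \<noteq> 0\<close>
  into one nonvanishing vector, the difference of two coordinates. It therefore survives small
  perturbations by continuity.\<close>

lemma segments_real_affine:
  fixes s :: "'n::finite \<Rightarrow> real"
  assumes "(s k1 - s k2) *\<^sub>R z \<noteq> 0"
  shows "(\<chi> k. l + s k *\<^sub>R z) \<in> segments"
proof -
  have "l + s k1 *\<^sub>R z \<noteq> l + s k2 *\<^sub>R z"
    using assms by (simp add: algebra_simps)
  moreover have "collinear (range (\<lambda>k. l + s k *\<^sub>R z))"
    unfolding collinear_alt by blast
  moreover have "l + s k1 *\<^sub>R z = l + s k2 *\<^sub>R z"
    if "(\<chi> k. l + s k *\<^sub>R z) = (\<chi> k. b)" for b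
    using that unfolding vec_eq_iff vec_lambda_beta by (metis (no_types))
  ultimately show ?thesis
    unfolding segments_def diagonal_tuples_def by auto
qed

text \<open>The parametrization is redundant: a constant \<open>x\<close> can be absorbed into
  \<open>m\<close>, and an \<open>x\<close> proportional to \<open>s\<close> into \<open>w\<close>.
  This leaves 2 + 2 + n - 2 = n + 2 real dimensions, while the redundant form allows each parameter
  to be tested separately.\<close>

lemma tangent_space_segments:
  fixes s :: "'n::finite \<Rightarrow> real"
  assumes z: "z \<noteq> 0" and s: "s k1 \<noteq> s k2"
  shows "tangent_space segments (\<chi> k. l + s k *\<^sub>R z) =
    {v. \<exists>m w x. v = (\<chi> k. m + s k *\<^sub>R w + x k *\<^sub>R z)}" (is "?L = ?R")
proof (intro set_eqI iffI)
  fix v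
  assume "v \<in> ?R"
  then obtain m w x where v: "v = (\<chi> k. m + s k *\<^sub>R w + x k *\<^sub>R z)"
    by blast
  define c where "c t = (\<chi> k. (l + t *\<^sub>R m) + (s k + t *\<^sub>R x k) *\<^sub>R (z + t *\<^sub>R w))" for t
  \<comment> \<open>\<open>h t\<close> is the difference of the coordinates \<open>k1\<close> and
    \<open>k2\<close> of \<open>c t\<close>; while it is nonzero, \<open>c t\<close> stays off the
    diagonal.\<close>
  define h where "h t = ((s k1 + t *\<^sub>R x k1) - (s k2 + t *\<^sub>R x k2)) *\<^sub>R (z + t *\<^sub>R w)" for t
  have "isCont h 0"
    unfolding h_def by (intro continuous_intros)
  moreover have "h 0 \<noteq> 0"
    using z s by (simp add: h_def)
  ultimately obtain \<delta> where \<delta>: "\<delta> > 0" "\<And>t. dist 0 t < \<delta> \<Longrightarrow> h t \<noteq> 0"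
    using continuous_at_avoid[of 0 h 0] by metis
  have "c t \<in> segments" if "t \<in> {-\<delta><..<\<delta>}" for t
    using \<delta>(2)[of t] that unfolding c_def h_def
    by (intro segments_real_affine[of _ k1 k2]) (auto simp: abs_less_iff)
  moreover have "smooth_curve_on {-\<delta><..<\<delta>} c"
    unfolding c_def
    by (intro smooth_curve_on_vec_lambda smooth_curve_on_add smooth_curve_on_scaleR
        smooth_curve_on_affine)
  moreover have "(c has_vector_derivative v) (at 0)"
    unfolding c_def v
    by (rule has_vector_derivative_vec_lambda) (auto intro!: derivative_eq_intros)
  ultimately show "v \<in> ?L"
    unfolding tangent_space_def using \<delta>(1) by (auto intro!: exI[of _ \<delta>] exI[of _ c] simp: c_def)
next
  fix v
  assume "v \<in> ?L"
  then obtain \<delta> c where \<delta>: "\<delta> > 0" and seg: "\<And>t. t \<in> {-\<delta><..<\<delta>} \<Longrightarrow> c t \<in> segments"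
    and c0: "c 0 = (\<chi> k. l + s k *\<^sub>R z)" and c': "(c has_vector_derivative v) (at 0)"
    unfolding tangent_space_def by blast
  define d where "d = s k1 - s k2"
  have d: "d \<noteq> 0"
    using s by (simp add: d_def)
  \<comment> \<open>The redundancy is used to normalize: with this \<open>w\<close> the coefficients
    \<open>x k1\<close> and \<open>x k2\<close> are 0, and \<open>m\<close> has to be
    \<open>v $ k2 - s k2 *\<^sub>R w\<close>.\<close>
  define w where "w = (v $ k1 - v $ k2) /\<^sub>R d"
  define x where "x k = Re ((v $ k - v $ k2 - (s k - s k2) *\<^sub>R w) / z)" for k
  have comp: "((\<lambda>t. c t $ k) has_vector_derivative v $ k) (at 0)" for k
    by (rule bounded_linear.has_vector_derivative[OF bounded_linear_vec_nth c'])
  have v: "v $ k = (v $ k2 - s k2 *\<^sub>R w) + s k *\<^sub>R w + x k *\<^sub>R z" for k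
  proof -
    let ?h = "\<lambda>t. Im ((c t $ k - c t $ k2) * cnj (c t $ k1 - c t $ k2))"
    let ?D = "Im ((c 0 $ k - c 0 $ k2) * cnj (v $ k1 - v $ k2)
          + (v $ k - v $ k2) * cnj (c 0 $ k1 - c 0 $ k2))"
    have "(?h has_vector_derivative ?D) (at 0)"
      by (intro bounded_linear.has_vector_derivative[OF bounded_linear_Im]
          has_vector_derivative_mult bounded_linear.has_vector_derivative[OF bounded_linear_cnj]
          has_vector_derivative_diff comp)
    moreover have "(?h has_vector_derivative 0) (at 0)"
    proof (rule has_vector_derivative_transform_within_open)
      show "((\<lambda>t. 0::real) has_vector_derivative 0) (at 0)"
        by simp
      show "0 \<in> {-\<delta><..<\<delta>}"
        using \<delta> by simp
      show "0 = ?h t" if "t \<in> {-\<delta><..<\<delta>}" for t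
      proof -
        have "collinear (range (\<lambda>k. c t $ k))"
          using seg[OF that] by (simp add: segments_def)
        then show ?thesis
          by (rule collinear_imp_Im_eq_0[symmetric]) simp_all
      qed
    qed simp
    ultimately have D: "?D = 0"
      by (rule vector_derivative_unique_at)
    have vw: "v $ k1 - v $ k2 = d *\<^sub>R w"
      using d by (simp add: w_def)
    \<comment> \<open>\<open>e\<close> is what remains of coordinate \<open>k\<close> after the
      affine part; it has to be shown parallel to \<open>z\<close>.\<close>
    define e where "e = v $ k - v $ k2 - (s k - s k2) *\<^sub>R w"
    have "?D = Im ((s k - s k2) *\<^sub>R z * cnj (d *\<^sub>R w)
        + (e + (s k - s k2) *\<^sub>R w) * cnj (d *\<^sub>R z))"
      unfolding c0 vw by (simp add: e_def d_def algebra_simps)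
    \<comment> \<open>The terms with \<open>w\<close> cancel, because
      \<open>z * cnj w + w * cnj z\<close> is real.\<close>
    also have "\<dots> = d * Im (e * cnj z)"
      by (simp add: algebra_simps)
    finally have "Im (e * cnj z) = 0"
      using D d by simp
    then have "Im (e / z) = 0"
      by (simp add: Im_divide)
    then have "e / z = of_real (x k)"
      unfolding x_def e_def[symmetric] by (simp add: complex_eq_iff)
    then have "e = x k *\<^sub>R z"
      using z by (simp add: field_simps scaleR_conv_of_real)
    then show ?thesis
      by (simp add: e_def algebra_simps)
  qed
  have "v = (\<chi> k. (v $ k2 - s k2 *\<^sub>R w) + s k *\<^sub>R w + x k *\<^sub>R z)"
    unfolding vec_eq_iff vec_lambda_beta using v by blast
  then show "v \<in> ?R"
    by blast
qed

text \<open>The inner product with a tangent vector splits into one term for each of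
  \<open>m\<close>, \<open>w\<close> and \<open>x\<close>, and these vary independently. Taking
  \<open>m\<close> or \<open>w\<close> to be the very sum it is paired with makes that sum vanish;
  an indicator function for \<open>x\<close> isolates one coordinate.\<close>

lemma orthogonal_tangent_space_segments:
  fixes a :: "complex ^ 'n"
  assumes z: "z \<noteq> 0" and s: "s k1 \<noteq> s k2"
  shows "(\<forall>v\<in>tangent_space segments (\<chi> k. l + s k *\<^sub>R z). orthogonal a v) \<longleftrightarrow>
    (\<Sum>k\<in>UNIV. a $ k) = 0 \<and> (\<Sum>k\<in>UNIV. s k *\<^sub>R a $ k) = 0 \<and> (\<forall>k. a $ k \<bullet> z = 0)"
    (is "?L \<longleftrightarrow> ?R")
proof -
  have inner: "a \<bullet> (\<chi> k. m + s k *\<^sub>R w + x k *\<^sub>R z) =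
      (\<Sum>k\<in>UNIV. a $ k) \<bullet> m + (\<Sum>k\<in>UNIV. s k *\<^sub>R a $ k) \<bullet> w + (\<Sum>k\<in>UNIV. x k * (a $ k \<bullet> z))"
    for m w x
    by (simp add: inner_vec_def inner_add_right sum.distrib inner_sum_left)
  have "?L \<longleftrightarrow> (\<forall>m w x. a \<bullet> (\<chi> k. m + s k *\<^sub>R w + x k *\<^sub>R z) = 0)"
    unfolding tangent_space_segments[OF assms] orthogonal_def by blast
  also have "\<dots> \<longleftrightarrow> ?R"
  proof
    assume *: "\<forall>m w x. a \<bullet> (\<chi> k. m + s k *\<^sub>R w + x k *\<^sub>R z) = 0"
    have "(\<Sum>k\<in>UNIV. a $ k) \<bullet> (\<Sum>k\<in>UNIV. a $ k) = 0"
      using *[rule_format, of "\<Sum>k\<in>UNIV. a $ k" 0 "\<lambda>_. 0"] unfolding inner by simp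
    moreover have "(\<Sum>k\<in>UNIV. s k *\<^sub>R a $ k) \<bullet> (\<Sum>k\<in>UNIV. s k *\<^sub>R a $ k) = 0"
      using *[rule_format, of 0 "\<Sum>k\<in>UNIV. s k *\<^sub>R a $ k" "\<lambda>_. 0"] unfolding inner by simp
    moreover have "a $ j \<bullet> z = 0" for j
      using *[rule_format, of 0 0 "\<lambda>k. if k = j then 1 else 0"] unfolding inner
      by (simp add: if_distrib[of "\<lambda>x. x * _"] cong: if_cong)
    ultimately show ?R
      by simp
  qed (simp add: inner)
  finally show ?thesis .
qed

section \<open>The geodesic equations\<close>

text \<open>\<open>z\<close> and \<open>\<i> * z\<close> form an orthogonal basis of the plane:
  \<open>w \<bullet> z\<close> and \<open>w \<bullet> (\<i> * z)\<close> are the real and imaginary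
  parts of \<open>w * cnj z\<close>.\<close>

lemma complex_eq_0_iff_inner:
  fixes z w :: complex
  assumes "z \<noteq> 0"
  shows "w = 0 \<longleftrightarrow> w \<bullet> z = 0 \<and> w \<bullet> (\<i> * z) = 0"
proof
  assume "w \<bullet> z = 0 \<and> w \<bullet> (\<i> * z) = 0"
  then have "w * cnj z = 0"
    by (simp add: complex_eq_iff inner_complex_def algebra_simps)
  then show "w = 0"
    using assms by simp
qed simp

lemma sum_split_12:
  fixes f :: "nat \<Rightarrow> 'b::comm_monoid_add"
  assumes "n \<ge> 3" and "bij_betw pos UNIV {1..n}"
  shows "(\<Sum>k\<in>UNIV. f (pos k)) = f 1 + (f 2 + (\<Sum>j=3..n. f j))"
proof -
  have "(\<Sum>k\<in>UNIV. f (pos k)) = (\<Sum>j\<in>{1..n}. f j)"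
    by (rule sum.reindex_bij_betw[OF assms(2)])
  also have "{1..n} = insert 1 (insert 2 {3..n})"
    using assms(1) by auto
  finally show ?thesis
    by simp
qed

theorem mainTheorem6:
  fixes n :: nat
    and pos :: "'n::finite \<Rightarrow> nat"
    and \<epsilon> :: real
    and z l :: "real \<Rightarrow> complex"
    and r :: "nat \<Rightarrow> real \<Rightarrow> real"
    and \<gamma> \<Lambda> \<gamma>hat :: "real \<Rightarrow> complex ^ 'n"
  assumes n: "n \<ge> 3"
    and pos: "bij_betw pos UNIV {1..n}"
    and \<epsilon>: "\<epsilon> > 0"
    and z_smooth: "smooth_curve_on {-\<epsilon><..<\<epsilon>} z"
    and z_nonzero: "\<And>t. t \<in> {-\<epsilon><..<\<epsilon>} \<Longrightarrow> z t \<noteq> 0"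
    and r_smooth: "\<And>j. j \<in> {3..n} \<Longrightarrow> smooth_curve_on {-\<epsilon><..<\<epsilon>} (r j)"
    and l_smooth: "smooth_curve_on {-\<epsilon><..<\<epsilon>} l"
    and \<gamma>: "\<And>t. t \<in> {-\<epsilon><..<\<epsilon>} \<Longrightarrow> \<gamma> t = z t *s shape_tuple pos (\<lambda>j. r j t)"
    and \<Lambda>: "\<And>t. t \<in> {-\<epsilon><..<\<epsilon>} \<Longrightarrow> \<Lambda> t = (\<chi> k. l t)"
    and \<gamma>hat: "\<And>t. t \<in> {-\<epsilon><..<\<epsilon>} \<Longrightarrow> \<gamma>hat t = \<gamma> t + \<Lambda> t"
  shows "geodesic_on {-\<epsilon><..<\<epsilon>} segments \<gamma>hat \<longleftrightarrow>
    (\<forall>t\<in>{-\<epsilon><..<\<epsilon>}.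
      ((1 + (\<Sum>j=3..n. (r j t)\<^sup>2)) *\<^sub>R vd (vd z) t
        + (2 * (\<Sum>j=3..n. r j t * vd (r j) t)) *\<^sub>R vd z t
        + (1 + (\<Sum>j=3..n. r j t)) *\<^sub>R vd (vd l) t) \<bullet> (\<i> * z t) = 0
      \<and> vd (vd z) t \<bullet> z t + vd (vd l) t \<bullet> z t = 0
      \<and> (\<forall>j\<in>{3..n}.
          z t \<bullet> (vd (vd (r j)) t *\<^sub>R z t + (2 * vd (r j) t) *\<^sub>R vd z t
                + (r j t - 1) *\<^sub>R vd (vd z) t) = 0)
      \<and> (1 + (\<Sum>j=3..n. r j t)) *\<^sub>R vd (vd z) t
        + (2 * (\<Sum>j=3..n. vd (r j) t)) *\<^sub>R vd z t
        + (\<Sum>j=3..n. vd (vd (r j)) t) *\<^sub>R z t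
        + real n *\<^sub>R vd (vd l) t = 0)
    \<and> (\<exists>k0::real. \<forall>t\<in>{-\<epsilon><..<\<epsilon>}.
        (\<Sum>j=3..n. (vd (r j) t)\<^sup>2) * (norm (z t))\<^sup>2
        + (\<Sum>j=3..n. 2 * vd (r j) t * r j t * (z t \<bullet> vd z t))
        + (1 + (\<Sum>j=3..n. (r j t)\<^sup>2)) * (norm (vd z t))\<^sup>2
        + 2 * (\<Sum>j=3..n. vd (r j) t) * (z t \<bullet> vd l t)
        + 2 * (1 + (\<Sum>j=3..n. r j t)) * (vd z t \<bullet> vd l t)
        + real n * (norm (vd l t))\<^sup>2 = k0)"
proof -

  \<comment> \<open>Position, velocity and acceleration in coordinates\<close>
  let ?I = "{-\<epsilon><..<\<epsilon>}"
  \<comment> \<open>The fixed entries 0 and 1 are treated as constant functions, so that every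
    coordinate has the same form \<open>l t + \<rho> j t *\<^sub>R z t\<close>.\<close>
  define \<rho> where "\<rho> j = (if j = 1 then \<lambda>_. 0 else if j = 2 then \<lambda>_. 1 else r j)" for j
  define V where "V j t = vd l t + (\<rho> j t *\<^sub>R vd z t + vd (\<rho> j) t *\<^sub>R z t)" for j t
  \<comment> \<open>The two equal mixed terms stay separate, since this is the shape that the
    product rule yields from \<open>V\<close>; they are merged in \<open>Ar\<close>.\<close>
  define A where "A j t = vd (vd l) t + ((\<rho> j t *\<^sub>R vd (vd z) t + vd (\<rho> j) t *\<^sub>R vd z t)
      + (vd (\<rho> j) t *\<^sub>R vd z t + vd (vd (\<rho> j)) t *\<^sub>R z t))" for j t
  note split = sum_split_12[OF n pos]
  have \<rho>1: "\<rho> 1 = (\<lambda>_. 0)" and \<rho>2: "\<rho> 2 = (\<lambda>_. 1)" and \<rho>r: "\<And>j. j \<in> {3..n} \<Longrightarrow> \<rho> j = r j"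
    by (auto simp: \<rho>_def)
  have pos_mem: "pos k \<in> {1..n}" for k
    using pos by (auto simp: bij_betw_def)
  have "1 \<in> range pos" "2 \<in> range pos"
    using pos n by (auto simp: bij_betw_def)
  then obtain k1 k2 where k1: "pos k1 = 1" and k2: "pos k2 = 2"
    by (metis imageE)
  have \<rho>_smooth: "smooth_curve_on ?I (\<rho> (pos k))" for k
    using pos_mem[of k] r_smooth[of "pos k"] by (auto simp: \<rho>_def smooth_curve_on_const)
  note z' = smooth_curve_on_derivatives[OF open_greaterThanLessThan z_smooth]
  note l' = smooth_curve_on_derivatives[OF open_greaterThanLessThan l_smooth]
  note \<rho>' = smooth_curve_on_derivatives[OF open_greaterThanLessThan \<rho>_smooth]
  have curve: "\<gamma>hat t = (\<chi> k. l t + \<rho> (pos k) t *\<^sub>R z t)" if "t \<in> ?I" for t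
    using that by (auto simp: \<gamma>hat \<gamma> \<Lambda> shape_tuple_def \<rho>_def vec_eq_iff scaleR_conv_of_real)
  have smooth: "smooth_curve_on ?I \<gamma>hat"
    by (rule smooth_curve_on_cong[OF _ curve[symmetric]])
      (intro smooth_curve_on_vec_lambda smooth_curve_on_add smooth_curve_on_scaleR
        l_smooth \<rho>_smooth z_smooth)
  have seg: "\<gamma>hat t \<in> segments" if "t \<in> ?I" for t
    unfolding curve[OF that] using z_nonzero[OF that]
    by (intro segments_real_affine[of _ k2 k1]) (unfold k1 k2 \<rho>1 \<rho>2, simp)
  have vel: "vd \<gamma>hat t = (\<chi> k. V (pos k) t)" if t: "t \<in> ?I" for t
  proof -
    have "vd \<gamma>hat t = vd (\<lambda>t. \<chi> k. l t + \<rho> (pos k) t *\<^sub>R z t) t"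
      using curve t by (intro vd_cong_on[of ?I]) auto
    also have "\<dots> = (\<chi> k. V (pos k) t)"
      unfolding V_def
      by (intro vector_derivative_at has_vector_derivative_vec_lambda has_vector_derivative_add
          has_vector_derivative_scaleR l' z' t
          \<rho>'[folded has_real_derivative_iff_has_vector_derivative])
    finally show ?thesis .
  qed
  have acc: "vd (vd \<gamma>hat) t = (\<chi> k. A (pos k) t)" if t: "t \<in> ?I" for t
  proof -
    have "vd (vd \<gamma>hat) t = vd (\<lambda>t. \<chi> k. V (pos k) t) t"
      using vel t by (intro vd_cong_on[of ?I]) auto
    also have "\<dots> = (\<chi> k. A (pos k) t)"
      unfolding V_def A_def
      by (intro vector_derivative_at has_vector_derivative_vec_lambda has_vector_derivative_add
          has_vector_derivative_scaleR l' z' t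
          \<rho>'[folded has_real_derivative_iff_has_vector_derivative])
    finally show ?thesis .
  qed
  have A1: "A 1 t = vd (vd l) t" and A2: "A 2 t = vd (vd z) t + vd (vd l) t"
    and Ar: "\<And>j. j \<in> {3..n} \<Longrightarrow> A j t = vd (vd l) t + (r j t *\<^sub>R vd (vd z) t
      + (2 * vd (r j) t) *\<^sub>R vd z t + vd (vd (r j)) t *\<^sub>R z t)" for t
    by (simp_all only: A_def \<rho>1 \<rho>2 \<rho>r) (simp_all add: scaleR_conv_of_real algebra_simps)
  have V1: "V 1 t = vd l t" and V2: "V 2 t = vd z t + vd l t"
    and Vr: "\<And>j. j \<in> {3..n} \<Longrightarrow> V j t = vd l t + (r j t *\<^sub>R vd z t + vd (r j) t *\<^sub>R z t)" for t
    by (simp_all only: V_def \<rho>1 \<rho>2 \<rho>r) simp_all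

  \<comment> \<open>Constant speed and (V')\<close>
  have speed: "(norm (vd \<gamma>hat t))\<^sup>2 =
      (\<Sum>j=3..n. (vd (r j) t)\<^sup>2) * (norm (z t))\<^sup>2
        + (\<Sum>j=3..n. 2 * vd (r j) t * r j t * (z t \<bullet> vd z t))
        + (1 + (\<Sum>j=3..n. (r j t)\<^sup>2)) * (norm (vd z t))\<^sup>2
        + 2 * (\<Sum>j=3..n. vd (r j) t) * (z t \<bullet> vd l t)
        + 2 * (1 + (\<Sum>j=3..n. r j t)) * (vd z t \<bullet> vd l t)
        + real n * (norm (vd l t))\<^sup>2" (is "_ = ?E t") if t: "t \<in> ?I" for t
  proof -
    have "(norm (vd \<gamma>hat t))\<^sup>2 = (\<Sum>k\<in>UNIV. (norm (V (pos k) t))\<^sup>2)"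
      unfolding vel[OF t] power2_norm_eq_inner inner_vec_def by simp
    also have "\<dots> = (norm (vd l t))\<^sup>2 + ((norm (vd z t + vd l t))\<^sup>2
        + (\<Sum>j=3..n. (norm (vd l t + (r j t *\<^sub>R vd z t + vd (r j) t *\<^sub>R z t)))\<^sup>2))"
      unfolding split[of "\<lambda>j. (norm (V j t))\<^sup>2"] V1 V2 by (simp add: Vr)
    also have "(\<Sum>j=3..n. (norm (vd l t + (r j t *\<^sub>R vd z t + vd (r j) t *\<^sub>R z t)))\<^sup>2) =
        (\<Sum>j=3..n. (norm (vd l t))\<^sup>2 + (r j t)\<^sup>2 * (norm (vd z t))\<^sup>2
          + (vd (r j) t)\<^sup>2 * (norm (z t))\<^sup>2 + 2 * r j t * (vd z t \<bullet> vd l t)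
          + 2 * vd (r j) t * (z t \<bullet> vd l t) + 2 * vd (r j) t * r j t * (z t \<bullet> vd z t))"
      unfolding power2_norm_eq_inner
      by (intro sum.cong refl) (simp add: inner_simps inner_commute power2_eq_square algebra_simps)
    \<comment> \<open>Coordinates 1 and 2 and the n - 2 others each contribute one squared norm of
      \<open>vd l t\<close>, which gives the factor n.\<close>
    also have "(norm (vd l t))\<^sup>2 + ((norm (vd z t + vd l t))\<^sup>2 + \<dots>) = ?E t"
      unfolding power2_norm_eq_inner
      using n by (simp add: sum.distrib sum_distrib_right sum_distrib_left
          of_nat_diff inner_add_left inner_add_right inner_commute[of "vd l t" "vd z t"]
          algebra_simps)
    finally show ?thesis .
  qed
  have const_speed: "(\<exists>s. \<forall>t\<in>?I. norm (vd \<gamma>hat t) = s) \<longleftrightarrow> (\<exists>k0. \<forall>t\<in>?I. ?E t = k0)"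
  proof
    assume "\<exists>s. \<forall>t\<in>?I. norm (vd \<gamma>hat t) = s"
    then obtain s where "norm (vd \<gamma>hat t) = s" if "t \<in> ?I" for t
      by blast
    then have "?E t = s\<^sup>2" if "t \<in> ?I" for t
      using speed[OF that, symmetric] that by simp
    then show "\<exists>k0. \<forall>t\<in>?I. ?E t = k0"
      by blast
  next
    assume "\<exists>k0. \<forall>t\<in>?I. ?E t = k0"
    then obtain k0 where "?E t = k0" if "t \<in> ?I" for t
      by blast
    then have "(norm (vd \<gamma>hat t))\<^sup>2 = k0" if "t \<in> ?I" for t
      using speed[OF that] that by simp
    then have "norm (vd \<gamma>hat t) = sqrt k0" if "t \<in> ?I" for t
      using that by (metis norm_ge_zero real_sqrt_unique)
    then show "\<exists>s. \<forall>t\<in>?I. norm (vd \<gamma>hat t) = s"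
      by blast
  qed

  \<comment> \<open>Normal acceleration and (I') to (IV')\<close>
  have orth: "(\<forall>v\<in>tangent_space segments (\<gamma>hat t). orthogonal (vd (vd \<gamma>hat) t) v) \<longleftrightarrow>
      ((1 + (\<Sum>j=3..n. (r j t)\<^sup>2)) *\<^sub>R vd (vd z) t
        + (2 * (\<Sum>j=3..n. r j t * vd (r j) t)) *\<^sub>R vd z t
        + (1 + (\<Sum>j=3..n. r j t)) *\<^sub>R vd (vd l) t) \<bullet> (\<i> * z t) = 0
      \<and> vd (vd z) t \<bullet> z t + vd (vd l) t \<bullet> z t = 0
      \<and> (\<forall>j\<in>{3..n}.
          z t \<bullet> (vd (vd (r j)) t *\<^sub>R z t + (2 * vd (r j) t) *\<^sub>R vd z t
                + (r j t - 1) *\<^sub>R vd (vd z) t) = 0)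
      \<and> (1 + (\<Sum>j=3..n. r j t)) *\<^sub>R vd (vd z) t
        + (2 * (\<Sum>j=3..n. vd (r j) t)) *\<^sub>R vd z t
        + (\<Sum>j=3..n. vd (vd (r j)) t) *\<^sub>R z t
        + real n *\<^sub>R vd (vd l) t = 0"
    (is "?L \<longleftrightarrow> ?M \<bullet> _ = 0 \<and> ?II \<and> (\<forall>j\<in>_. ?III j) \<and> ?S = 0") if t: "t \<in> ?I" for t
  proof -
    have sum_A: "(\<Sum>k\<in>UNIV. A (pos k) t) = ?S"
      unfolding split[of "\<lambda>j. A j t"] A1 A2 using n
      by (simp add: Ar sum.distrib scaleR_sum_left sum_distrib_left
          of_nat_diff algebra_simps) (simp add: scaleR_conv_of_real)
    \<comment> \<open>Index 1 has weight 0 and drops out. The vector of (I') omits a real multiple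
      of \<open>z t\<close>, which pairing with \<open>\<i> * z t\<close> cannot detect.\<close>
    have sum_\<rho>A: "(\<Sum>k\<in>UNIV. \<rho> (pos k) t *\<^sub>R A (pos k) t) =
        ?M + (\<Sum>j=3..n. r j t * vd (vd (r j)) t) *\<^sub>R z t"
      unfolding split[of "\<lambda>j. \<rho> j t *\<^sub>R A j t"] A2 \<rho>1 \<rho>2
      by (simp add: Ar \<rho>r sum.distrib scaleR_sum_left sum_distrib_left
          scaleR_add_right power2_eq_square mult.left_commute[of _ 2] algebra_simps)
    have all_A: "(\<forall>k. A (pos k) t \<bullet> z t = 0) \<longleftrightarrow>
        A 1 t \<bullet> z t = 0 \<and> A 2 t \<bullet> z t = 0 \<and> (\<forall>j\<in>{3..n}. A j t \<bullet> z t = 0)"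
    proof -
      have "(\<forall>k. A (pos k) t \<bullet> z t = 0) \<longleftrightarrow> (\<forall>j\<in>{1..n}. A j t \<bullet> z t = 0)"
        using pos unfolding bij_betw_def by (metis imageE rangeI)
      also have "{1..n} = insert 1 (insert 2 {3..n})"
        using n by auto
      finally show ?thesis
        by simp
    qed
    have II: "A 2 t \<bullet> z t = 0 \<longleftrightarrow> ?II"
      by (simp add: A2 inner_add_left)
    have III: "A j t \<bullet> z t = 0 \<longleftrightarrow> ?III j" if "A 2 t \<bullet> z t = 0" "j \<in> {3..n}" for j
    proof -
      \<comment> \<open>(III') is the orthogonality for index \<open>j\<close> minus (II'):
        \<open>vd (vd l) t\<close> cancels, and subtracting \<open>vd (vd z) t\<close> turns
        \<open>r j t\<close> into \<open>r j t - 1\<close>.\<close>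
      have "A j t \<bullet> z t = A 2 t \<bullet> z t + z t \<bullet> (vd (vd (r j)) t *\<^sub>R z t
          + (2 * vd (r j) t) *\<^sub>R vd z t + (r j t - 1) *\<^sub>R vd (vd z) t)"
        using that(2) by (simp add: Ar A2 inner_simps inner_commute algebra_simps)
      then show ?thesis
        using that(1) by simp
    qed
    have first: "A 1 t \<bullet> z t = 0"
      if "?S = 0" "A 2 t \<bullet> z t = 0" "\<forall>j\<in>{3..n}. A j t \<bullet> z t = 0"
    proof -
      have "0 = (\<Sum>k\<in>UNIV. A (pos k) t) \<bullet> z t"
        using that(1) sum_A by simp
      also have "\<dots> = A 1 t \<bullet> z t"
        unfolding split[of "\<lambda>j. A j t"] using that by (simp add: inner_add_left inner_sum_left)
      finally show ?thesis
        by simp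
    qed
    have moment: "(\<Sum>k\<in>UNIV. \<rho> (pos k) t *\<^sub>R A (pos k) t) = 0 \<longleftrightarrow> ?M \<bullet> (\<i> * z t) = 0"
      if "\<forall>k. A (pos k) t \<bullet> z t = 0"
    proof -
      let ?W = "\<Sum>k\<in>UNIV. \<rho> (pos k) t *\<^sub>R A (pos k) t"
      \<comment> \<open>The component along \<open>z t\<close> vanishes term by term, so only the
        one along \<open>\<i> * z t\<close> is a new condition.\<close>
      have radial: "?W \<bullet> z t = 0"
        using that by (simp add: inner_sum_left)
      have "z t \<bullet> (\<i> * z t) = 0"
        by (simp add: inner_complex_def)
      then have rotational: "?W \<bullet> (\<i> * z t) = ?M \<bullet> (\<i> * z t)"
        unfolding sum_\<rho>A by (simp add: inner_add_left)
      show ?thesis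
        unfolding complex_eq_0_iff_inner[OF z_nonzero[OF t], of ?W] radial rotational by simp
    qed
    have "\<rho> (pos k1) t \<noteq> \<rho> (pos k2) t"
      unfolding k1 k2 \<rho>1 \<rho>2 by simp
    then have "?L \<longleftrightarrow> ?S = 0 \<and> (\<Sum>k\<in>UNIV. \<rho> (pos k) t *\<^sub>R A (pos k) t) = 0
        \<and> (\<forall>k. A (pos k) t \<bullet> z t = 0)"
      unfolding curve[OF t] acc[OF t]
      using orthogonal_tangent_space_segments[OF z_nonzero[OF t],
          of "\<lambda>k. \<rho> (pos k) t" k1 k2 "l t" "\<chi> k. A (pos k) t"]
      by (simp only: vec_lambda_beta sum_A simp_thms)
    then show ?thesis
      using all_A II III first moment by blast
  qed
  show ?thesis
    unfolding geodesic_on_def const_speed using smooth seg orth by auto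
qed

end
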